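(* Let $\beta>0$, $n\ge 1$, and let $\mathcal{H}$ be the chained model built from trial models $\mathcal{C}_{i|\mathbf{c}_{<i}\mathbf{z}_{<i}e}$, $i=1,\dots,n$. For each $i$ let $F_i=F_i(C_iZ_i;\mathbf{C}_{<i}\mathbf{Z}_{<i})$ be a past-parameterized probability estimation factor (PEF) with power $\beta$ for the $i$'th trial, and let $T_n=\prod_{i=1}^n F_i$. Suppose that the joint distribution $\mu$ of $\mathbf{Z}$, $\mathbf{C}$ and $E$ satisfies the chained model $\mathcal{H}$. Let $1\geq\kappa,\epsilon>0$ and $1\geq p\geq 1/|\mathrm{Rng}(\mathbf{C})|$ with $p>0$. Define $\{\phi\}$ to be the event that $T_n\geq 1/(p^{\beta}\epsilon)$, and suppose $\kappa\leq \mathbb{P}_\mu(\phi)$. Then the $\epsilon$-smooth $\mathbf{Z}E$-conditional min-entropy of $\mathbf{C}$, evaluated conditionally on $\{\phi\}$ (that is, for the distribution $\mu(\mathbf{C}\mathbf{Z}E|\phi)$), satisfies $$H_{\min}^{\epsilon}(\mathbf{C}|\mathbf{Z}E;\phi)\ \geq\ -\log_2\!\left(p/\kappa^{1+1/\beta}\right).$$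
   Context: All random variables (RVs) have countable value spaces; $\mathrm{Rng}(X)$ is the value space of $X$, and $1/|\mathrm{Rng}(X)|$ is read as $0$ if the value space is infinite. Conditional probabilities whose conditioner has probability zero are set to $0$, and zero-probability values are ignored ("for all values" means for all values of positive probability). $\mathbf{Z}=(Z_i)_{i=1}^n$ (inputs) and $\mathbf{C}=(C_i)_{i=1}^n$ (outputs) are sequences of RVs, $\mathbf{C}_{<i}=(C_j)_{j=1}^{i-1}$, similarly $\mathbf{Z}_{<i}$, and $E$ is an RV (the side information). Models: a model is a set of probability distributions. For each trial $i$, each past $\mathbf{c}_{<i}\mathbf{z}_{<i}$ and each $e$, the trial model $\mathcal{C}_{i|\mathbf{c}_{<i}\mathbf{z}_{<i}e}$ is a set of distributions of $C_iZ_i$. The chained model $\mathcal{H}$ is the set of distributions $\mu_e$ of $\mathbf{C}\mathbf{Z}$ (thought of as conditional on $E=e$) such that (1) for all $i$ and $\mathbf{c}_{<i},\mathbf{z}_{<i}$, the conditional distribution $\mu_e(C_iZ_i|\mathbf{c}_{<i}\mathbf{z}_{<i})$ is in $\mathcal{C}_{i|\mathbf{c}_{<i}\mathbf{z}_{<i}e}$; and (2) for all $i$, under $\mu_e$, $Z_i$ is independent of $\mathbf{C}_{<i}$ conditionally on $\mathbf{Z}_{<i}$. A joint distribution $\mu$ of $\mathbf{Z},\mathbf{C},E$ satisfies $\mathcal{H}$ if for every $e$ the conditional distribution $\mu(\mathbf{C}\mathbf{Z}|E=e)$ satisfies (1) and (2) for that $e$. PEFs: for $\beta>0$ and a set $\mathcal{C}$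 of distributions of $CZ$, a PEF with power $\beta$ for $\mathcal{C}$ is a function $F:cz\mapsto F(cz)\ge 0$ with $\mathbb{E}_\sigma\big(F(CZ)\,\sigma(C|Z)^\beta\big)=\sum_{cz}F(cz)\sigma(c|z)^\beta\sigma(cz)\le 1$ for all $\sigma\in\mathcal{C}$. "Past-parameterized PEF for the $i$'th trial" means that for every past $\mathbf{c}_{<i}\mathbf{z}_{<i}$, the function $F_i(\,\cdot\,;\mathbf{c}_{<i}\mathbf{z}_{<i})$ is a PEF with power $\beta$ for $\mathcal{C}_{i|\mathbf{c}_{<i}\mathbf{z}_{<i}e}$ for every $e$ (and $F_i$ does not depend on $e$). Smooth min-entropy: the total-variation distance is $\mathrm{TV}(\nu,\nu')=\frac12\sum_x|\nu(x)-\nu'(x)|$. For a distribution $\mu$ of $CZE$ and $\epsilon\ge0$, $P^{\epsilon}_{\max,\mu}(C|ZE)$ is the minimum (infimum) of the $p$ for which there is a distribution $\nu$ of $CZE$ with $\mathrm{TV}(\nu,\mu)\le\epsilon$ and $\sum_{ze}\max_c(\nu(c|ze))\,\nu(ze)\le p$; the $\epsilon$-smooth $ZE$-conditional min-entropy is $H^{\epsilon}_{\min,\mu}(C|ZE)=-\log_2 P^{\epsilon}_{\max,\mu}(C|ZE)$. *)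

theory Defs
  imports "HOL-Probability.Probability"
begin

text \<open>
  Random variables with countable value spaces are described by their joint distribution, a
  \<^typ>\<open>'a pmf\<close> supported on the product of the value spaces.  Value spaces are explicit sets, since
  their cardinality matters and each trial has its own.  Trials are indexed \<open>0, \<dots>, n - 1\<close>, a sequence
  of results is a list \<open>xs\<close> of length \<open>n\<close>, \<^term>\<open>xs ! i\<close> is the result of trial \<open>i\<close> and
  \<^term>\<open>take i xs\<close> is the past of trial \<open>i\<close>.

  The library's \<^const>\<open>cond_prob\<close> is a quotient of probabilities, hence \<open>0\<close> when the condition
  has probability zero.  \<^const>\<open>cond_pmf\<close> is only used on events of positive probability.
\<close>

definition seq_space :: "(nat \<Rightarrow> 'a set) \<Rightarrow> nat \<Rightarrow> 'a list set" where
  "seq_space R n = {xs. length xs = n \<and> (\<forall>i<n. xs ! i \<in> R i)}"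


subsection \<open>Models\<close>

text \<open>\<open>X\<close> and \<open>Y\<close> are independent conditionally on \<open>W\<close>.\<close>

definition cond_indep :: "'w pmf \<Rightarrow> ('w \<Rightarrow> 'x) \<Rightarrow> ('w \<Rightarrow> 'y) \<Rightarrow> ('w \<Rightarrow> 'v) \<Rightarrow> bool" where
  "cond_indep \<mu> X Y W \<longleftrightarrow> (\<forall>x y w.
     \<P>(\<omega> in measure_pmf \<mu>. X \<omega> = x \<and> Y \<omega> = y \<bar> W \<omega> = w) =
     \<P>(\<omega> in measure_pmf \<mu>. X \<omega> = x \<bar> W \<omega> = w) * \<P>(\<omega> in measure_pmf \<mu>. Y \<omega> = y \<bar> W \<omega> = w))"

definition past_event :: "nat \<Rightarrow> 'c list \<Rightarrow> 'z list \<Rightarrow> ('c list \<times> 'z list) set" where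
  "past_event i cp zp = {(cs, zs). take i cs = cp \<and> take i zs = zp}"

text \<open>\<open>M i cp zp e\<close> is the model of trial \<open>i\<close> given the past \<open>cp\<close>, \<open>zp\<close> and the side information \<open>e\<close>.\<close>

type_synonym ('c, 'z, 'e) trial_models =
  "nat \<Rightarrow> 'c list \<Rightarrow> 'z list \<Rightarrow> 'e \<Rightarrow> ('c \<times> 'z) pmf set"

definition trial_models_on ::
  "nat \<Rightarrow> (nat \<Rightarrow> 'c set) \<Rightarrow> (nat \<Rightarrow> 'z set) \<Rightarrow> 'e set \<Rightarrow> ('c, 'z, 'e) trial_models \<Rightarrow> bool" where
  "trial_models_on n RC RZ RE M \<longleftrightarrow>
     (\<forall>i<n. \<forall>cp\<in>seq_space RC i. \<forall>zp\<in>seq_space RZ i. \<forall>e\<in>RE.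
        \<forall>\<sigma>\<in>M i cp zp e. set_pmf \<sigma> \<subseteq> RC i \<times> RZ i)"

definition chained_model ::
  "nat \<Rightarrow> (nat \<Rightarrow> 'c set) \<Rightarrow> (nat \<Rightarrow> 'z set) \<Rightarrow> ('c, 'z, 'e) trial_models \<Rightarrow> 'e
     \<Rightarrow> ('c list \<times> 'z list) pmf set" where
  "chained_model n RC RZ M e = {\<mu>.
     set_pmf \<mu> \<subseteq> seq_space RC n \<times> seq_space RZ n \<and>
     (\<forall>i<n. \<forall>cp zp. set_pmf \<mu> \<inter> past_event i cp zp \<noteq> {} \<longrightarrow>
        map_pmf (\<lambda>(cs, zs). (cs ! i, zs ! i)) (cond_pmf \<mu> (past_event i cp zp)) \<in> M i cp zp e) \<and>
     (\<forall>i<n. cond_indep \<mu> (\<lambda>(cs, zs). zs ! i) (\<lambda>(cs, zs). take i cs) (\<lambda>(cs, zs). take i zs))}"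

definition satisfies_model ::
  "('c \<times> 'z \<times> 'e) pmf \<Rightarrow> ('e \<Rightarrow> ('c \<times> 'z) pmf set) \<Rightarrow> bool" where
  "satisfies_model \<mu> H \<longleftrightarrow> (\<forall>e. set_pmf \<mu> \<inter> {(c, z, e'). e' = e} \<noteq> {} \<longrightarrow>
     map_pmf (\<lambda>(c, z, e'). (c, z)) (cond_pmf \<mu> {(c, z, e'). e' = e}) \<in> H e)"


subsection \<open>Probability estimation factors\<close>

text \<open>\<open>V\<close> is the value space of \<open>CZ\<close>.  The nonnegative integral of \<^term>\<open>measure_pmf \<sigma>\<close> is the
  expectation with value in \<open>[0, \<infinity>]\<close>, so the bound includes convergence.\<close>

definition is_PEF :: "real \<Rightarrow> ('c \<times> 'z) set \<Rightarrow> ('c \<times> 'z) pmf set \<Rightarrow> ('c \<times> 'z \<Rightarrow> real) \<Rightarrow> bool" where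
  "is_PEF \<beta> V M F \<longleftrightarrow> (\<forall>cz\<in>V. F cz \<ge> 0) \<and>
     (\<forall>\<sigma>\<in>M. (\<integral>\<^sup>+ (c, z). ennreal (F (c, z) *
         \<P>(\<omega> in measure_pmf \<sigma>. fst \<omega> = c \<bar> snd \<omega> = z) powr \<beta>) \<partial>measure_pmf \<sigma>) \<le> 1)"

definition is_past_param_PEF ::
  "real \<Rightarrow> (nat \<Rightarrow> 'c set) \<Rightarrow> (nat \<Rightarrow> 'z set) \<Rightarrow> 'e set \<Rightarrow> ('c, 'z, 'e) trial_models \<Rightarrow> nat
     \<Rightarrow> ('c list \<Rightarrow> 'z list \<Rightarrow> 'c \<times> 'z \<Rightarrow> real) \<Rightarrow> bool" where
  "is_past_param_PEF \<beta> RC RZ RE M i F \<longleftrightarrow>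
     (\<forall>cp\<in>seq_space RC i. \<forall>zp\<in>seq_space RZ i. \<forall>e\<in>RE.
        is_PEF \<beta> (RC i \<times> RZ i) (M i cp zp e) (F cp zp))"

definition PEF_product ::
  "nat \<Rightarrow> (nat \<Rightarrow> 'c list \<Rightarrow> 'z list \<Rightarrow> 'c \<times> 'z \<Rightarrow> real) \<Rightarrow> 'c list \<Rightarrow> 'z list \<Rightarrow> real" where
  "PEF_product n F cs zs = (\<Prod>i<n. F i (take i cs) (take i zs) (cs ! i, zs ! i))"


subsection \<open>Smooth conditional min-entropy\<close>

definition TV :: "'a pmf \<Rightarrow> 'a pmf \<Rightarrow> real" where
  "TV \<nu> \<nu>' = (1 / 2) * (\<Sum>\<^sub>\<infinity>x. \<bar>pmf \<nu> x - pmf \<nu>' x\<bar>)"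

text \<open>The supremum is a maximum: for each \<open>ze\<close> the values are nonnegative with sum at most \<open>1\<close>.\<close>

definition guess_prob :: "('c \<times> 'z \<times> 'e) pmf \<Rightarrow> real" where
  "guess_prob \<nu> = (\<Sum>\<^sub>\<infinity>ze. (SUP c. \<P>(\<omega> in measure_pmf \<nu>. fst \<omega> = c \<bar> snd \<omega> = ze)) *
                          pmf (map_pmf snd \<nu>) ze)"

text \<open>\<open>\<Omega>\<close> is the value space of \<open>CZE\<close>.\<close>

definition P_max :: "('c \<times> 'z \<times> 'e) set \<Rightarrow> real \<Rightarrow> ('c \<times> 'z \<times> 'e) pmf \<Rightarrow> real" where
  "P_max \<Omega> \<epsilon> \<mu> = Inf {p. \<exists>\<nu>. set_pmf \<nu> \<subseteq> \<Omega> \<and> TV \<nu> \<mu> \<le> \<epsilon> \<and> guess_prob \<nu> \<le> p}"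

text \<open>For \<open>\<epsilon> = 1\<close> and an infinite value space of \<open>C\<close> the infimum is \<open>0\<close> and the entropy infinite, whereas
  \<^term>\<open>log 2 0 = (0::real)\<close>.\<close>

definition H_min :: "('c \<times> 'z \<times> 'e) set \<Rightarrow> real \<Rightarrow> ('c \<times> 'z \<times> 'e) pmf \<Rightarrow> ereal" where
  "H_min \<Omega> \<epsilon> \<mu> = (if P_max \<Omega> \<epsilon> \<mu> = 0 then \<infinity> else ereal (- log 2 (P_max \<Omega> \<epsilon> \<mu>)))"

end

theory Submission
  imports Defs
begin

text \<open>
  Conditional independence makes \<open>\<mu>\<^sub>e(\<^bold>c|\<^bold>z)\<close> the product over \<open>i\<close> of the conditional probabilities of
  \<open>c\<^sub>i\<close> given \<open>z\<^sub>i\<close> and the past, so the trial inequalities chain and give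
  \<open>E(T\<^sub>n \<mu>(\<^bold>C|\<^bold>ZE)\<^sup>\<beta>) \<le> 1\<close>.  By Markov's inequality the event
  \<open>T\<^sub>n \<mu>(\<^bold>C|\<^bold>ZE)\<^sup>\<beta> \<ge> 1 / (\<epsilon> \<kappa>)\<close> has probability at most \<open>\<epsilon> \<kappa> \<le> \<epsilon> P(\<phi>)\<close>, hence at most \<open>\<epsilon>\<close>
  conditionally on \<open>\<phi>\<close>; off this event, on \<open>\<phi>\<close>, we have
  \<open>\<mu>(\<^bold>c|\<^bold>ze) \<le> q = p / \<kappa>\<^bsup>1/\<beta>\<^esup>\<close>.  There \<open>\<mu>(\<^bold>c\<^bold>ze|\<phi>) \<le> m(\<^bold>ze) = q \<mu>(\<^bold>ze) / P(\<phi>)\<close>.  Moving the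
  remaining mass below the envelope \<open>m\<close> gives a distribution within \<open>\<epsilon>\<close> of \<open>\<mu>(\<^bold>C\<^bold>ZE|\<phi>)\<close> whose
  guessing probability is at most \<open>\<Sum> m = q / P(\<phi>) \<le> p / \<kappa>\<^bsup>1+1/\<beta>\<^esup>\<close>.
\<close>

subsection \<open>Smoothing and guessing probability\<close>

lemma pmf_has_sum: "(pmf p has_sum measure_pmf.prob p A) A"
proof -
  have "Infinite_Sum.abs_summable_on (pmf p) A"
    by (subst abs_summable_equivalent) auto
  then have "pmf p summable_on A"
    by (simp add: abs_summable_summable)
  moreover have "measure_pmf.prob p A = infsum (pmf p) A"
    by (simp add: measure_pmf_conv_infsetsum infsetsum_infsum pmf_abs_summable)
  ultimately show ?thesis
    by (simp add: has_sum_infsum)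
qed

lemma nn_integral_count_space_has_sum:
  fixes f :: "'a \<Rightarrow> real"
  assumes "(f has_sum s) A" and nonneg: "\<And>x. x \<in> A \<Longrightarrow> f x \<ge> 0"
  shows "(\<integral>\<^sup>+x. ennreal (f x) \<partial>count_space A) = ennreal s"
proof -
  have "f summable_on A"
    using assms(1) by (auto simp: summable_on_def)
  then have "(\<lambda>x. norm (f x)) summable_on A"
    by (rule summable_on_cong[THEN iffD1, rotated]) (simp add: nonneg)
  then have "Infinite_Set_Sum.abs_summable_on f A"
    by (simp only: abs_summable_equivalent)
  then show ?thesis
    by (simp add: nn_integral_conv_infsetsum nonneg infsetsum_infsum infsumI[OF assms(1)])
qed

lemma pmf_of_has_sum:
  fixes f :: "'a \<Rightarrow> real"
  assumes "(f has_sum 1) UNIV" and "\<And>x. f x \<ge> 0"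
  obtains p where "\<And>x. pmf p x = f x"
  using pmf_embed_pmf[of f] nn_integral_count_space_has_sum[OF assms(1)] assms(2) by auto

lemma cond_prob_fst_snd_pmf:
  "\<P>(\<omega> in measure_pmf \<nu>. fst \<omega> = c \<bar> snd \<omega> = x) = pmf \<nu> (c, x) / pmf (map_pmf snd \<nu>) x"
proof -
  have "{\<omega>. fst \<omega> = c \<and> snd \<omega> = x} = {(c, x)}" "{\<omega>. snd \<omega> = x} = snd -` {x}"
    by auto
  then show ?thesis
    by (simp add: cond_prob_def pmf_map measure_pmf_single vimage_def)
qed

lemma cond_prob_pmf_bounds:
  "0 \<le> cond_prob (measure_pmf p) P Q" "cond_prob (measure_pmf p) P Q \<le> 1"
proof -
  have "measure_pmf.prob p {\<omega>. P \<omega> \<and> Q \<omega>} \<le> measure_pmf.prob p {\<omega>. Q \<omega>}"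
    by (intro measure_pmf.finite_measure_mono) auto
  then show "cond_prob (measure_pmf p) P Q \<le> 1"
    by (simp add: cond_prob_def divide_le_eq_1 zero_less_measure_iff)
qed (simp add: cond_prob_def)

lemma has_sum_diff_real:
  fixes f g :: "'a \<Rightarrow> real"
  assumes "(f has_sum a) A" and "(g has_sum b) A"
  shows "((\<lambda>x. f x - g x) has_sum (a - b)) A"
  using has_sum_add[OF assms(1) has_sum_cmult_right[OF assms(2), of "-1"]] by simp

text \<open>Bounds the candidates in \<open>P_max\<close> from below, without which their
  \<open>Inf\<close> in the reals would carry no information.\<close>

lemma guess_prob_nonneg: "guess_prob \<nu> \<ge> 0"
  unfolding guess_prob_def
proof (intro infsum_nonneg mult_nonneg_nonneg pmf_nonneg)
  fix x
  have "bdd_above (range (\<lambda>c. \<P>(\<omega> in measure_pmf \<nu>. fst \<omega> = c \<bar> snd \<omega> = x)))"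
    by (rule bdd_aboveI[of _ 1]) (auto simp: cond_prob_pmf_bounds)
  then show "0 \<le> (SUP c. \<P>(\<omega> in measure_pmf \<nu>. fst \<omega> = c \<bar> snd \<omega> = x))"
    by (rule cSUP_upper2[OF _ UNIV_I]) (simp add: cond_prob_pmf_bounds)
qed

text \<open>Multiplying by the marginal undoes the conditioning, so each summand of
  \<open>guess_prob\<close> is a supremum of joint probabilities over c, which the envelope
  dominates. Where the marginal vanishes the summand is 0.\<close>

lemma guess_prob_le:
  assumes m: "(m has_sum s) UNIV" and le: "\<And>c x. pmf \<nu> (c, x) \<le> m x"
  shows "guess_prob \<nu> \<le> s"
proof -
  let ?P = "\<lambda>c x. \<P>(\<omega> in measure_pmf \<nu>. fst \<omega> = c \<bar> snd \<omega> = x)"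
  have m0: "0 \<le> m x" for x
    by (rule order_trans[OF pmf_nonneg le])
  have term_le: "(SUP c. ?P c x) * pmf (map_pmf snd \<nu>) x \<le> m x" for x
  proof (cases "pmf (map_pmf snd \<nu>) x = 0")
    case False
    then have pos: "0 < pmf (map_pmf snd \<nu>) x"
      by (simp add: order_less_le)
    have "(SUP c. ?P c x) \<le> m x / pmf (map_pmf snd \<nu>) x"
      unfolding cond_prob_fst_snd_pmf
      by (rule cSUP_least[OF UNIV_not_empty divide_right_mono[OF le pmf_nonneg]])
    with pos show ?thesis
      by (simp add: pos_le_divide_eq)
  qed (simp add: m0)
  have bdd: "bdd_above (range (\<lambda>c. ?P c x))" for x
    by (rule bdd_aboveI[of _ 1]) (auto simp: cond_prob_pmf_bounds)
  have term_nonneg: "0 \<le> (SUP c. ?P c x) * pmf (map_pmf snd \<nu>) x" for x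
    by (rule mult_nonneg_nonneg[OF cSUP_upper2[OF bdd UNIV_I cond_prob_pmf_bounds(1)] pmf_nonneg])
  have msum: "m summable_on UNIV"
    using m by (auto simp: summable_on_def)
  have "guess_prob \<nu> \<le> infsum m UNIV"
    unfolding guess_prob_def
    by (rule infsum_mono[OF summable_on_comparison_test[OF msum term_le term_nonneg] msum term_le])
  then show ?thesis
    by (simp add: infsumI[OF m])
qed

section \<open>Smoothing below an envelope\<close>

lemma has_sum_finite_Times:
  fixes m :: "'x \<Rightarrow> real"
  assumes "finite K" and m: "(m has_sum s) UNIV" and m0: "\<And>x. m x \<ge> 0"
  shows "((\<lambda>(c, x). if c \<in> K then m x else 0) has_sum (real (card K) * s)) UNIV"
proof -
  have "((\<lambda>(c, x). m x) has_sum (real (card K) * s)) (K \<times> UNIV)"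
  proof (rule has_sum_SigmaI)
    show "((\<lambda>c. s) has_sum (real (card K) * s)) K"
      using has_sum_finite[OF assms(1), of "\<lambda>c. s"] by simp
    show "(\<lambda>(c, x). m x) summable_on K \<times> UNIV"
      by (rule summable_on_SigmaI[where g = "\<lambda>_. s"]) (auto simp: m m0 assms(1))
  qed (simp add: m)
  then show ?thesis
    by (rule has_sum_cong_neutral[THEN iffD1, rotated -1]) (auto split: if_splits)
qed

text \<open>The mass lost by restricting \<open>\<rho>\<close> to \<open>A\<close> is put into the room left below the envelope \<open>m\<close> over
  \<open>K\<close>; there is enough room since \<open>card K * s \<ge> 1\<close>.\<close>

lemma smoothing_below_envelope:
  fixes \<rho> :: "('c \<times> 'x) pmf" and m :: "'x \<Rightarrow> real"
  assumes m: "(m has_sum s) UNIV" and m0: "\<And>x. m x \<ge> 0"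
    and le: "\<And>c x. (c, x) \<in> A \<Longrightarrow> pmf \<rho> (c, x) \<le> m x"
    and K: "finite K" "real (card K) * s \<ge> 1"
  obtains \<nu> where "set_pmf \<nu> \<subseteq> set_pmf \<rho> \<union> K \<times> {x. m x \<noteq> 0}"
    and "TV \<nu> \<rho> \<le> 1 - measure_pmf.prob \<rho> A"
    and "\<And>c x. pmf \<nu> (c, x) \<le> m x"
proof -
  \<comment> \<open>\<open>f\<close> is the part of \<rho> that is kept. \<open>r\<close> is the
    free room over \<open>K\<close>: the envelope minus what \<open>f\<close> already occupies
    there.\<close>
  define f where "f = (\<lambda>cx. if cx \<in> A then pmf \<rho> cx else 0)"
  define r where "r = (\<lambda>cx. (case cx of (c, x) \<Rightarrow> if c \<in> K then m x else 0)
    - (if cx \<in> K \<times> UNIV \<inter> A then pmf \<rho> cx else 0))"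
  define \<delta> where "\<delta> = 1 - measure_pmf.prob \<rho> A"
  have restr: "((\<lambda>cx. if cx \<in> B then pmf \<rho> cx else 0) has_sum measure_pmf.prob \<rho> B) UNIV" for B
    by (rule has_sum_cong_neutral[THEN iffD1, OF _ _ _ pmf_has_sum]) auto
  \<comment> \<open>Each c in \<open>K\<close> carries one copy of the envelope, so the capacity is
    \<open>card K * s\<close>; the kept mass over \<open>K\<close> is deducted.\<close>
  define R where "R = real (card K) * s - measure_pmf.prob \<rho> (K \<times> UNIV \<inter> A)"
  have rsum: "(r has_sum R) UNIV"
    using has_sum_diff_real[OF has_sum_finite_Times[OF K(1) m m0] restr[of "K \<times> UNIV \<inter> A"]]
    by (simp only: r_def R_def)
  have r0: "r cx \<ge> 0" for cx
    using le m0 by (auto simp: r_def split: prod.splits)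
  have \<delta>R: "\<delta> \<le> R"
    using K(2) measure_pmf.finite_measure_mono[of "K \<times> UNIV \<inter> A" A \<rho>]
    by (simp add: \<delta>_def R_def)
  have \<delta>0: "0 \<le> \<delta>"
    by (simp add: \<delta>_def)
  \<comment> \<open>The missing mass \<delta> is spread in proportion to the room. If
    \<open>R = 0\<close>, then \<delta> = 0 as well, and division by zero gives
    \<open>t = 0\<close>, so \<open>t * R = \<delta>\<close> still holds.\<close>
  define t where "t = \<delta> / R"
  have t: "0 \<le> t" "t \<le> 1" "t * R = \<delta>"
    using \<delta>R \<delta>0 by (auto simp: t_def divide_le_eq_1)
  have fr_sum: "((\<lambda>cx. f cx + t * r cx) has_sum 1) UNIV"
    using has_sum_add[OF restr[of A] has_sum_cmult_right[OF rsum, of t]] t(3)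
    by (simp add: f_def \<delta>_def)
  have f0: "f cx \<ge> 0" "f cx \<le> pmf \<rho> cx" for cx
    by (auto simp: f_def)
  obtain \<nu> where \<nu>: "\<And>cx. pmf \<nu> cx = f cx + t * r cx"
    using pmf_of_has_sum[OF fr_sum add_nonneg_nonneg[OF f0(1) mult_nonneg_nonneg[OF t(1) r0]]]
    by blast
  show ?thesis
  proof (rule that)
    show "set_pmf \<nu> \<subseteq> set_pmf \<rho> \<union> K \<times> {x. m x \<noteq> 0}"
      by (auto simp: set_pmf_iff \<nu> f_def r_def split: if_splits)
    show "pmf \<nu> (c, x) \<le> m x" for c x
    proof -
      have "t * r (c, x) \<le> r (c, x)"
        using r0 t mult_left_le_one_le by blast
      then have "pmf \<nu> (c, x) \<le> f (c, x) + r (c, x)"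
        by (simp add: \<nu>)
      \<comment> \<open>Over \<open>K\<close> the sum \<open>f + r\<close> is exactly
        \<open>m\<close>; elsewhere \<open>r\<close> is 0 and \<open>f\<close> lies below
        \<open>m\<close>.\<close>
      also have "\<dots> \<le> m x"
        using le m0 by (auto simp: f_def r_def)
      finally show ?thesis .
    qed
    \<comment> \<open>Added mass and removed mass are \<delta> each; the factor 1/2 in
      \<open>TV\<close> turns 2 \<delta> into \<delta>.\<close>
    have dsum: "((\<lambda>cx. t * r cx + (pmf \<rho> cx - f cx)) has_sum 2 * \<delta>) UNIV"
      using has_sum_add[OF has_sum_cmult_right[OF rsum, of t]
          has_sum_diff_real[OF pmf_has_sum[of \<rho> UNIV] restr[of A]]] t(3)
      by (simp add: f_def \<delta>_def)
    have dle: "\<bar>pmf \<nu> cx - pmf \<rho> cx\<bar> \<le> t * r cx + (pmf \<rho> cx - f cx)" for cx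
      using f0[of cx] mult_nonneg_nonneg[OF t(1) r0[of cx]] by (simp add: \<nu>)
    have summ: "(\<lambda>cx. t * r cx + (pmf \<rho> cx - f cx)) summable_on UNIV"
      using dsum by (rule has_sum_imp_summable)
    have "(\<Sum>\<^sub>\<infinity>cx. \<bar>pmf \<nu> cx - pmf \<rho> cx\<bar>) \<le> (\<Sum>\<^sub>\<infinity>cx. t * r cx + (pmf \<rho> cx - f cx))"
      by (rule infsum_mono[OF summable_on_comparison_test[OF summ dle abs_ge_zero] summ dle])
    then show "TV \<nu> \<rho> \<le> 1 - measure_pmf.prob \<rho> A"
      by (simp add: TV_def infsumI[OF dsum] \<delta>_def)
  qed
qed

text \<open>Supplies the finite set of outputs over which the envelope has room enough. A finite
  \<open>S\<close> serves itself; in an infinite one any subset of at least 1/p elements will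
  do.\<close>

lemma obtain_finite_subset_card_ge:
  assumes "S \<noteq> {}" and "0 < p"
    and "p \<ge> (if finite S then 1 / real (card S) else 0)"
  obtains K where "K \<subseteq> S" "finite K" "real (card K) * p \<ge> 1"
proof (cases "finite S")
  case True
  then have "real (card S) * p \<ge> 1"
    using assms by (simp add: card_gt_0_iff field_simps)
  with True show ?thesis
    using that by blast
next
  case False
  obtain k :: nat where k: "1 / p \<le> real k"
    using real_arch_simple by blast
  obtain K where "K \<subseteq> S" "finite K" "card K = k"
    using infinite_arbitrarily_large[OF False] by blast
  with k assms(2) show ?thesis
    by (intro that) (auto simp: field_simps)
qed


subsection \<open>Chaining\<close>

lemma bind_cond_pmf_fibres: "bind_pmf (map_pmf h p) (\<lambda>y. cond_pmf p {x. h x = y}) = p"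
proof (rule bind_cond_pmf_cancel)
  show "measure_pmf.prob p {y'. h y' = x} = measure_pmf.prob (map_pmf h p) {x'. h y = x'}"
    if "h y = x" for x y
    using that by (auto intro!: arg_cong[where f = "measure_pmf.prob p"])
qed auto

text \<open>The tower property: averaging the conditional expectations given h recovers the
  expectation.\<close>

lemma nn_integral_fibres:
  "(\<integral>\<^sup>+x. f x \<partial>measure_pmf p) =
   (\<integral>\<^sup>+y. (\<integral>\<^sup>+x. f x \<partial>measure_pmf (cond_pmf p {x. h x = y})) \<partial>measure_pmf (map_pmf h p))"
  by (subst (1) bind_cond_pmf_fibres[of h p, symmetric]) (simp only: nn_integral_bind_pmf)

lemma measure_cond_pmf:
  assumes "set_pmf p \<inter> S \<noteq> {}"
  shows "measure_pmf.prob (cond_pmf p S) A = measure_pmf.prob p (S \<inter> A) / measure_pmf.prob p S"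
  unfolding cond_pmf.rep_eq[OF assms]
  by (rule measure_uniform_measure) (simp_all add: emeasure_measure_pmf_not_zero[OF assms])

text \<open>The condition contains the first i inputs only, not all n of them, which is what permits
  a recursion in i. For lists of length n the case \<open>i = n\<close> is the full conditional
  probability of outputs given inputs.\<close>

definition prefix_cond_prob ::
  "('c list \<times> 'z list) pmf \<Rightarrow> nat \<Rightarrow> 'c list \<Rightarrow> 'z list \<Rightarrow> real" where
  "prefix_cond_prob \<rho> i cs zs =
     \<P>(\<omega> in measure_pmf \<rho>. take i (fst \<omega>) = take i cs \<bar> take i (snd \<omega>) = take i zs)"

lemma take_Suc_eq_iff:
  assumes "i < length xs" "i < length ys"
  shows "take (Suc i) xs = take (Suc i) ys \<longleftrightarrow> take i xs = take i ys \<and> xs ! i = ys ! i"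
  using assms by (simp add: take_Suc_conv_app_nth)

text \<open>By conditional independence, adding the input of trial i to the condition does not
  change the probability of the past outputs. The chain rule then splits off the probability of the
  new output given its input and the past.\<close>

lemma prefix_cond_prob_Suc:
  assumes indep: "cond_indep \<rho> (\<lambda>(cs, zs). zs ! i) (\<lambda>(cs, zs). take i cs) (\<lambda>(cs, zs). take i zs)"
    and len: "\<And>cs zs. (cs, zs) \<in> set_pmf \<rho> \<Longrightarrow> i < length cs \<and> i < length zs"
    and supp: "(cs, zs) \<in> set_pmf \<rho>"
    and \<sigma>: "\<sigma> = map_pmf (\<lambda>(cs, zs). (cs ! i, zs ! i))
      (cond_pmf \<rho> (past_event i (take i cs) (take i zs)))"
  shows "prefix_cond_prob \<rho> (Suc i) cs zs =
    prefix_cond_prob \<rho> i cs zs * \<P>(\<omega> in measure_pmf \<sigma>. fst \<omega> = cs ! i \<bar> snd \<omega> = zs ! i)"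
proof -
  let ?P = "\<lambda>\<Phi>. measure_pmf.prob \<rho> {\<omega>. \<Phi> (fst \<omega>) (snd \<omega>)}"
  define A where "A = ?P (\<lambda>c z. take i c = take i cs \<and> take i z = take i zs)"
  define B where "B = ?P (\<lambda>c z. take i z = take i zs)"
  define A1 where "A1 = ?P (\<lambda>c z. take i c = take i cs \<and> take i z = take i zs \<and> z ! i = zs ! i)"
  define B1 where "B1 = ?P (\<lambda>c z. take i z = take i zs \<and> z ! i = zs ! i)"
  define A2 where "A2 = ?P (\<lambda>c z. take i c = take i cs \<and> take i z = take i zs \<and> c ! i = cs ! i \<and> z ! i = zs ! i)"
  note defs = A_def B_def A1_def B1_def A2_def
  have pos: "A > 0" "B > 0" "A1 > 0" "B1 > 0"
    unfolding defs by (rule measure_pmf_posI[OF supp]; simp)+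
  \<comment> \<open>Splitting a prefix of length \<open>Suc i\<close> into the past and entry i
    needs lists longer than i, so the events agree only almost surely.\<close>
  have "measure_pmf.prob \<rho> {\<omega>. take (Suc i) (fst \<omega>) = take (Suc i) cs \<and>
      take (Suc i) (snd \<omega>) = take (Suc i) zs} = A2"
    unfolding defs using len len[OF supp]
    by (intro measure_pmf.finite_measure_eq_AE) (auto simp: AE_measure_pmf_iff take_Suc_eq_iff)
  moreover have "measure_pmf.prob \<rho> {\<omega>. take (Suc i) (snd \<omega>) = take (Suc i) zs} = B1"
    unfolding defs using len len[OF supp]
    by (intro measure_pmf.finite_measure_eq_AE) (auto simp: AE_measure_pmf_iff take_Suc_eq_iff)
  ultimately have "prefix_cond_prob \<rho> (Suc i) cs zs = A2 / B1"
    by (simp add: prefix_cond_prob_def cond_prob_def)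
  moreover have "prefix_cond_prob \<rho> i cs zs = A / B"
    by (simp add: prefix_cond_prob_def cond_prob_def defs)
  moreover have "\<P>(\<omega> in measure_pmf \<sigma>. fst \<omega> = cs ! i \<bar> snd \<omega> = zs ! i) = (A2 / A) / (A1 / A)"
  proof -
    have ne: "set_pmf \<rho> \<inter> past_event i (take i cs) (take i zs) \<noteq> {}"
      using supp by (auto simp: past_event_def)
    have "measure_pmf.prob \<sigma> {\<omega>. \<Phi> (fst \<omega>) (snd \<omega>)} =
      ?P (\<lambda>c z. take i c = take i cs \<and> take i z = take i zs \<and> \<Phi> (c ! i) (z ! i)) / A" for \<Phi>
      unfolding \<sigma> measure_map_pmf measure_cond_pmf[OF ne] A_def
      by (intro arg_cong2[where f = "(/)"] arg_cong[where f = "measure_pmf.prob \<rho>"])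
        (auto simp: past_event_def)
    from this[of "\<lambda>c z. c = cs ! i \<and> z = zs ! i"] this[of "\<lambda>c z. z = zs ! i"] show ?thesis
      by (simp add: cond_prob_def defs)
  qed
  moreover have "A1 / B = (B1 / B) * (A / B)"
    using indep[unfolded cond_indep_def, rule_format, of "zs ! i" "take i cs" "take i zs"]
    by (simp add: cond_prob_def split_beta defs conj_ac)
  \<comment> \<open>That is A1/B1 = A/B, the form in which independence enters the
    recursion.\<close>
  then have "A1 * B = B1 * A"
    using pos by (simp add: field_simps)
  then have "A2 / B1 = (A / B) * ((A2 / A) / (A1 / A))"
    using pos by (simp add: field_simps)
  ultimately show ?thesis
    by simp
qed

section \<open>The supermartingale inequality for products of factors\<close>

lemma PEF_product_Suc:
  "PEF_product (Suc i) F cs zs =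
    PEF_product i F cs zs * F i (take i cs) (take i zs) (cs ! i, zs ! i)"
  by (simp add: PEF_product_def)

lemma PEF_product_take_cong:
  assumes "take i cs = take i cs'" "take i zs = take i zs'"
  shows "PEF_product i F cs zs = PEF_product i F cs' zs'"
  unfolding PEF_product_def
proof (rule prod.cong)
  fix j assume "j \<in> {..<i}"
  then have "take j xs = take j (take i xs)" "xs ! j = take i xs ! j" for xs :: "'b list"
    by (simp_all add: min_def)
  moreover from \<open>j \<in> {..<i}\<close> have "take j xs = take j (take i xs)" "xs ! j = take i xs ! j" for xs :: "'a list"
    by (simp_all add: min_def)
  ultimately show "F j (take j cs) (take j zs) (cs ! j, zs ! j) =
    F j (take j cs') (take j zs') (cs' ! j, zs' ! j)"
    using assms by metis
qed simp

lemma seq_space_take: "xs \<in> seq_space R n \<Longrightarrow> i \<le> n \<Longrightarrow> take i xs \<in> seq_space R i"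
  by (auto simp: seq_space_def)

lemma is_past_param_PEF_nonneg:
  assumes "is_past_param_PEF \<beta> RC RZ RE M i F" "e \<in> RE" "i < n"
    and "cs \<in> seq_space RC n" "zs \<in> seq_space RZ n"
  shows "F (take i cs) (take i zs) (cs ! i, zs ! i) \<ge> 0"
proof -
  have "take i cs \<in> seq_space RC i" "take i zs \<in> seq_space RZ i" "(cs ! i, zs ! i) \<in> RC i \<times> RZ i"
    using assms by (auto intro: seq_space_take simp: seq_space_def)
  with assms(1,2) show ?thesis
    unfolding is_past_param_PEF_def is_PEF_def by blast
qed

lemma PEF_product_nonneg:
  assumes "\<And>i. i < n \<Longrightarrow> is_past_param_PEF \<beta> RC RZ RE M i (F i)" "e \<in> RE" "i \<le> n"
    and "cs \<in> seq_space RC n" "zs \<in> seq_space RZ n"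
  shows "PEF_product i F cs zs \<ge> 0"
  unfolding PEF_product_def
  by (rule prod_nonneg, rule is_past_param_PEF_nonneg[OF assms(1,2) _ assms(4,5)])
    (use assms(3) in auto)

text \<open>Induction on i. Given the past, the weighted product so far is a constant, and the new
  weighted factor has conditional expectation at most 1 by the PEF inequality for the trial model at
  that past.\<close>

lemma chained_PEF_expectation:
  fixes \<rho> :: "('c list \<times> 'z list) pmf"
  assumes PEF: "\<And>i. i < n \<Longrightarrow> is_past_param_PEF \<beta> RC RZ RE M i (F i)" and e: "e \<in> RE"
    and chained: "\<rho> \<in> chained_model n RC RZ M e"
    and "i \<le> n"
  shows "(\<integral>\<^sup>+(cs, zs). ennreal (PEF_product i F cs zs * prefix_cond_prob \<rho> i cs zs powr \<beta>)
    \<partial>measure_pmf \<rho>) \<le> 1"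
  using \<open>i \<le> n\<close>
proof (induction i)
  case 0
  then show ?case
    by (simp add: PEF_product_def prefix_cond_prob_def cond_prob_def case_prod_unfold)
next
  case (Suc i)
  then have i: "i < n"
    by simp
  have supp: "set_pmf \<rho> \<subseteq> seq_space RC n \<times> seq_space RZ n"
    and trial: "\<And>cp zp. set_pmf \<rho> \<inter> past_event i cp zp \<noteq> {} \<Longrightarrow>
        map_pmf (\<lambda>(cs, zs). (cs ! i, zs ! i)) (cond_pmf \<rho> (past_event i cp zp)) \<in> M i cp zp e"
    and indep: "cond_indep \<rho> (\<lambda>(cs, zs). zs ! i) (\<lambda>(cs, zs). take i cs) (\<lambda>(cs, zs). take i zs)"
    using chained i by (auto simp: chained_model_def)
  have len: "i < length cs \<and> i < length zs" if "(cs, zs) \<in> set_pmf \<rho>" for cs zs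
    using supp that i by (auto simp: seq_space_def)
  let ?G = "\<lambda>i (cs, zs). ennreal (PEF_product i F cs zs * prefix_cond_prob \<rho> i cs zs powr \<beta>)"
  let ?past = "\<lambda>(cs :: 'c list, zs :: 'z list). (take i cs, take i zs)"
  have step: "(\<integral>\<^sup>+x. ?G (Suc i) x \<partial>measure_pmf (cond_pmf \<rho> {x. ?past x = y})) \<le>
      (\<integral>\<^sup>+x. ?G i x \<partial>measure_pmf (cond_pmf \<rho> {x. ?past x = y}))"
    if y: "y \<in> ?past ` set_pmf \<rho>" for y
  proof -
    obtain cs0 zs0 where xs0: "(cs0, zs0) \<in> set_pmf \<rho>" "y = (take i cs0, take i zs0)"
      using y by auto
    define E where "E = past_event i (take i cs0) (take i zs0)"
    have E: "{x. ?past x = y} = E"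
      by (auto simp: E_def past_event_def xs0)
    have ne: "set_pmf \<rho> \<inter> E \<noteq> {}"
      using xs0 by (auto simp: E_def past_event_def)
    define \<sigma> where "\<sigma> = map_pmf (\<lambda>(cs, zs). (cs ! i, zs ! i)) (cond_pmf \<rho> E)"
    have \<sigma>M: "\<sigma> \<in> M i (take i cs0) (take i zs0) e"
      unfolding \<sigma>_def E_def by (rule trial) (use ne in \<open>simp add: E_def\<close>)
    have c0: "take i cs0 \<in> seq_space RC i" "take i zs0 \<in> seq_space RZ i"
      using xs0 supp i by (auto intro!: seq_space_take[where n = n])
    let ?f = "\<lambda>(c, z). ennreal (F i (take i cs0) (take i zs0) (c, z) *
      \<P>(\<omega> in measure_pmf \<sigma>. fst \<omega> = c \<bar> snd \<omega> = z) powr \<beta>)"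
    have f1: "(\<integral>\<^sup>+x. ?f x \<partial>measure_pmf \<sigma>) \<le> 1"
      using PEF[OF i] c0 e \<sigma>M unfolding is_past_param_PEF_def is_PEF_def by blast
    define a where "a = ?G i (cs0, zs0)"
    have past_eq: "?G i x = a" if "x \<in> E" for x
    proof -
      obtain cs zs where x: "x = (cs, zs)"
        by (cases x)
      have eq: "take i cs = take i cs0" "take i zs = take i zs0"
        using that by (auto simp: E_def past_event_def x)
      show ?thesis
        by (simp add: x a_def prefix_cond_prob_def eq PEF_product_take_cong[OF eq])
    qed
    \<comment> \<open>The recursions for the product and for the prefix probability combine.
      Nonnegativity is what lets \<open>powr\<close> and \<open>ennreal\<close> distribute over the
      products.\<close>
    have "?G (Suc i) x = a * ?f (fst x ! i, snd x ! i)" if x: "x \<in> set_pmf \<rho> \<inter> E" for x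
    proof -
      obtain cs zs where [simp]: "x = (cs, zs)"
        by (cases x)
      have xs: "(cs, zs) \<in> set_pmf \<rho>" "take i cs = take i cs0" "take i zs = take i zs0"
        using x by (auto simp: E_def past_event_def)
      have mem: "cs \<in> seq_space RC n" "zs \<in> seq_space RZ n"
        using xs supp by auto
      have "prefix_cond_prob \<rho> (Suc i) cs zs = prefix_cond_prob \<rho> i cs zs *
          \<P>(\<omega> in measure_pmf \<sigma>. fst \<omega> = cs ! i \<bar> snd \<omega> = zs ! i)"
        by (rule prefix_cond_prob_Suc[OF indep len xs(1)]) (assumption | simp only: \<sigma>_def E_def xs(2,3))+
      then have "PEF_product (Suc i) F cs zs * prefix_cond_prob \<rho> (Suc i) cs zs powr \<beta> =
          (PEF_product i F cs zs * prefix_cond_prob \<rho> i cs zs powr \<beta>) *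
          (F i (take i cs0) (take i zs0) (cs ! i, zs ! i) *
           \<P>(\<omega> in measure_pmf \<sigma>. fst \<omega> = cs ! i \<bar> snd \<omega> = zs ! i) powr \<beta>)"
        by (simp add: PEF_product_Suc xs powr_mult cond_prob_pmf_bounds prefix_cond_prob_def mult_ac)
      moreover have "0 \<le> PEF_product i F cs zs"
        by (rule PEF_product_nonneg[OF PEF e _ mem]) (use i in auto)
      ultimately show ?thesis
        using past_eq[of x] x by (simp add: ennreal_mult')
    qed
    then have "(\<integral>\<^sup>+x. ?G (Suc i) x \<partial>measure_pmf (cond_pmf \<rho> E)) =
        (\<integral>\<^sup>+x. a * ?f (fst x ! i, snd x ! i) \<partial>measure_pmf (cond_pmf \<rho> E))"
      by (intro nn_integral_cong_AE) (auto simp only: AE_measure_pmf_iff set_cond_pmf[OF ne])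
    also have "\<dots> = a * (\<integral>\<^sup>+x. ?f x \<partial>measure_pmf \<sigma>)"
      by (subst nn_integral_cmult) (simp_all add: \<sigma>_def case_prod_unfold)
    also have "\<dots> \<le> a"
      using mult_left_mono[OF f1, of a] by simp
    also have "a = (\<integral>\<^sup>+x. a \<partial>measure_pmf (cond_pmf \<rho> E))"
      by simp
    also have "\<dots> = (\<integral>\<^sup>+x. ?G i x \<partial>measure_pmf (cond_pmf \<rho> E))"
      by (intro nn_integral_cong_AE)
        (simp only: AE_measure_pmf_iff set_cond_pmf[OF ne], blast intro: past_eq[symmetric])
    finally show ?thesis
      by (simp only: E)
  qed
  have "(\<integral>\<^sup>+x. ?G (Suc i) x \<partial>measure_pmf \<rho>) \<le> (\<integral>\<^sup>+x. ?G i x \<partial>measure_pmf \<rho>)"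
    unfolding nn_integral_fibres[where p = \<rho> and h = ?past]
    by (rule nn_integral_mono_AE) (use step in \<open>simp only: AE_measure_pmf_iff set_map_pmf, blast\<close>)
  also have "\<dots> \<le> 1"
    using Suc by simp
  finally show ?case .
qed

section \<open>Averaging over the side information\<close>

lemma prefix_cond_prob_side_information:
  assumes supp: "(cs, zs, e) \<in> set_pmf \<mu>"
    and len: "\<And>cs zs e. (cs, zs, e) \<in> set_pmf \<mu> \<Longrightarrow> length cs = n \<and> length zs = n"
    and \<rho>: "\<rho> = map_pmf (\<lambda>(c, z, e'). (c, z)) (cond_pmf \<mu> {(c, z, e'). e' = e})"
  shows "prefix_cond_prob \<rho> n cs zs = pmf \<mu> (cs, zs, e) / pmf (map_pmf snd \<mu>) (zs, e)"
proof -
  let ?E = "{(c, z, e'). e' = e}"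
  have ne: "set_pmf \<mu> \<inter> ?E \<noteq> {}"
    using supp by auto
  define P where "P = measure_pmf.prob \<mu> ?E"
  have P: "P > 0"
    unfolding P_def by (rule measure_pmf_posI[OF supp]) simp
  \<comment> \<open>The events need to correspond on the support only, where lists have length n and
    \<open>take n\<close> is the identity.\<close>
  have prob: "measure_pmf.prob \<rho> B = measure_pmf.prob \<mu> S / P"
    if "\<And>c z e'. (c, z, e') \<in> set_pmf \<mu> \<Longrightarrow> (c, z, e') \<in> S \<longleftrightarrow> (c, z) \<in> B \<and> e' = e" for B S
    unfolding \<rho> measure_map_pmf measure_cond_pmf[OF ne] P_def
    by (intro arg_cong2[where f = "(/)"] measure_pmf.finite_measure_eq_AE)
      (use that in \<open>auto simp: AE_measure_pmf_iff\<close>)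
  have "measure_pmf.prob \<rho> {\<omega>. take n (fst \<omega>) = take n cs \<and> take n (snd \<omega>) = take n zs} =
      measure_pmf.prob \<mu> {(cs, zs, e)} / P"
    using len len[OF supp] by (intro prob) auto
  moreover have "measure_pmf.prob \<rho> {\<omega>. take n (snd \<omega>) = take n zs} =
      measure_pmf.prob \<mu> (snd -` {(zs, e)}) / P"
    using len len[OF supp] by (intro prob) auto
  \<comment> \<open>The normalisation 1/P of conditioning on e cancels in the quotient.\<close>
  ultimately show ?thesis
    using P by (simp add: prefix_cond_prob_def cond_prob_def pmf_map measure_pmf_single)
qed

lemma joint_PEF_expectation:
  assumes PEF: "\<And>i. i < n \<Longrightarrow> is_past_param_PEF \<beta> RC RZ RE M i (F i)"
    and supp: "set_pmf \<mu> \<subseteq> seq_space RC n \<times> seq_space RZ n \<times> RE"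
    and sat: "satisfies_model \<mu> (chained_model n RC RZ M)"
  shows "(\<integral>\<^sup>+(cs, zs, e). ennreal (PEF_product n F cs zs *
    (pmf \<mu> (cs, zs, e) / pmf (map_pmf snd \<mu>) (zs, e)) powr \<beta>) \<partial>measure_pmf \<mu>) \<le> 1"
    (is "(\<integral>\<^sup>+x. ?f x \<partial>_) \<le> 1")
proof -
  have len: "length cs = n \<and> length zs = n" if "(cs, zs, e) \<in> set_pmf \<mu>" for cs zs e
    using supp that by (auto simp: seq_space_def)
  have "(\<integral>\<^sup>+x. ?f x \<partial>measure_pmf (cond_pmf \<mu> {x. snd (snd x) = e})) \<le> 1"
    if e: "e \<in> (snd \<circ> snd) ` set_pmf \<mu>" for e
  proof -
    let ?E = "{(c, z, e'). e' = e}"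
    have E: "{x. snd (snd x) = e} = ?E"
      by auto
    have ne: "set_pmf \<mu> \<inter> ?E \<noteq> {}"
      using e by force
    define \<rho> where "\<rho> = map_pmf (\<lambda>(c, z, e'). (c, z)) (cond_pmf \<mu> ?E)"
    have chained: "\<rho> \<in> chained_model n RC RZ M e"
      using sat ne unfolding satisfies_model_def \<rho>_def by blast
    have eRE: "e \<in> RE"
      using e supp by auto
    let ?g = "\<lambda>(cs, zs). ennreal (PEF_product n F cs zs * prefix_cond_prob \<rho> n cs zs powr \<beta>)"
    have "?f x = ?g (case x of (c, z, e') \<Rightarrow> (c, z))" if "x \<in> set_pmf \<mu> \<inter> ?E" for x
      using that by (auto simp: prefix_cond_prob_side_information[OF _ len \<rho>_def])
    then have "(\<integral>\<^sup>+x. ?f x \<partial>measure_pmf (cond_pmf \<mu> ?E)) =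
        (\<integral>\<^sup>+x. ?g (case x of (c, z, e') \<Rightarrow> (c, z)) \<partial>measure_pmf (cond_pmf \<mu> ?E))"
      by (intro nn_integral_cong_AE) (simp only: AE_measure_pmf_iff set_cond_pmf[OF ne], blast)
    also have "\<dots> = (\<integral>\<^sup>+x. ?g x \<partial>measure_pmf \<rho>)"
      unfolding \<rho>_def nn_integral_map_pmf ..
    also have "\<dots> \<le> 1"
      by (rule chained_PEF_expectation[OF PEF eRE chained order_refl])
    finally show ?thesis
      by (simp only: E)
  qed
  then have "(\<integral>\<^sup>+x. ?f x \<partial>measure_pmf \<mu>) \<le> (\<integral>\<^sup>+e. 1 \<partial>measure_pmf (map_pmf (snd \<circ> snd) \<mu>))"
    unfolding nn_integral_fibres[where p = \<mu> and h = "snd \<circ> snd"] comp_apply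
    by (intro nn_integral_mono_AE) (simp only: AE_measure_pmf_iff set_map_pmf comp_apply, blast)
  then show ?thesis
    by simp
qed


subsection \<open>Min-entropy bound\<close>

theorem theorem1:
  fixes n :: nat and \<beta> \<kappa> \<epsilon> p :: real
    and RC :: "nat \<Rightarrow> 'c set" and RZ :: "nat \<Rightarrow> 'z set" and RE :: "'e set"
    and M :: "('c, 'z, 'e) trial_models"
    and F :: "nat \<Rightarrow> 'c list \<Rightarrow> 'z list \<Rightarrow> 'c \<times> 'z \<Rightarrow> real"
    and \<mu> :: "('c list \<times> 'z list \<times> 'e) pmf"
    and \<Omega> \<phi> :: "('c list \<times> 'z list \<times> 'e) set"
  assumes "\<beta> > 0" and "n \<ge> 1"
    and "\<And>i. i < n \<Longrightarrow> countable (RC i)" and "\<And>i. i < n \<Longrightarrow> countable (RZ i)" and "countable RE"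
    and \<Omega>: "\<Omega> = seq_space RC n \<times> seq_space RZ n \<times> RE"
    and "trial_models_on n RC RZ RE M"
    and "\<And>i. i < n \<Longrightarrow> is_past_param_PEF \<beta> RC RZ RE M i (F i)"
    and "set_pmf \<mu> \<subseteq> \<Omega>"
    and "satisfies_model \<mu> (chained_model n RC RZ M)"
    and "0 < \<kappa>" and "\<kappa> \<le> 1" and "0 < \<epsilon>" and "\<epsilon> \<le> 1"
    and "0 < p" and "p \<le> 1"
    and "p \<ge> (if finite (seq_space RC n) then 1 / real (card (seq_space RC n)) else 0)"
    and \<phi>: "\<phi> = {(cs, zs, e). PEF_product n F cs zs \<ge> 1 / (p powr \<beta> * \<epsilon>)}"
    and "\<kappa> \<le> measure_pmf.prob \<mu> \<phi>"
  shows "H_min \<Omega> \<epsilon> (cond_pmf \<mu> \<phi>) \<ge> ereal (- log 2 (p / \<kappa> powr (1 + 1 / \<beta>)))"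
proof -
  note \<beta> = \<open>\<beta> > 0\<close> and \<kappa> = \<open>0 < \<kappa>\<close> \<open>\<kappa> \<le> 1\<close> and \<epsilon> = \<open>0 < \<epsilon>\<close> and p = \<open>0 < p\<close>
  define P where "P = measure_pmf.prob \<mu> \<phi>"
  have P: "\<kappa> \<le> P" "0 < P" "P \<le> 1"
    using \<open>\<kappa> \<le> measure_pmf.prob \<mu> \<phi>\<close> \<kappa> by (auto simp: P_def)
  have ne: "set_pmf \<mu> \<inter> \<phi> \<noteq> {}"
    using P(2) measure_pmf_zero_iff[of \<mu> \<phi>] by (auto simp: P_def)
  define \<rho> where "\<rho> = cond_pmf \<mu> \<phi>"
  define marg where "marg = pmf (map_pmf snd \<mu>)"
  define g where "g = (\<lambda>(cs, ze). pmf \<mu> (cs, ze) / marg ze)"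
  \<comment> \<open>Chosen so that q^\<beta> = p^\<beta>/\<kappa>: on \<phi>, \<open>g x > q\<close>
    then forces T g^\<beta> \<ge> 1/(\<epsilon> \<kappa>), the threshold for Markov's
    inequality.\<close>
  define q where "q = p / \<kappa> powr (1 / \<beta>)"
  define A where "A = {x. g x \<le> q}"
  define m where "m = (\<lambda>ze. q / P * marg ze)"
  have q: "p \<le> q" "0 < q" "q powr \<beta> = p powr \<beta> / \<kappa>"
    using p \<kappa> \<beta> powr_mono2[of "1 / \<beta>" \<kappa> 1]
    by (simp_all add: q_def powr_divide powr_powr pos_le_divide_eq mult_left_le)
  \<comment> \<open>Carries the room \<open>card K * p \<ge> 1\<close> over to the total mass q/P of
    the envelope.\<close>
  have qP: "p \<le> q / P"
    using q p P by (simp add: pos_le_divide_eq) (metis mult_left_le order_trans less_imp_le)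

  have m_sum: "(m has_sum (q / P)) UNIV"
    using has_sum_cmult_right[OF pmf_has_sum[of "map_pmf snd \<mu>" UNIV], of "q / P"]
    by (simp add: m_def marg_def)
  have m0: "m ze \<ge> 0" for ze
    using q P by (simp add: m_def marg_def)
  have pmf_g: "pmf \<mu> (c, ze) = g (c, ze) * marg ze" for c ze
  proof (cases "marg ze = 0")
    case True
    then have "(c, ze) \<notin> set_pmf \<mu>"
      by (force simp: marg_def pmf_eq_0_set_pmf)
    with True show ?thesis
      by (simp add: pmf_eq_0_set_pmf)
  qed (simp add: g_def)
  \<comment> \<open>Conditioning on \<phi> multiplies a point mass by 1/P or makes it 0, which
    accounts for the 1/P in \<open>m\<close>.\<close>
  have \<rho>_le: "pmf \<rho> (c, ze) \<le> m ze" if "(c, ze) \<in> A" for c ze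
  proof -
    have "pmf \<rho> (c, ze) \<le> pmf \<mu> (c, ze) / P"
      using P by (simp add: \<rho>_def pmf_cond[OF ne] P_def)
    also have "\<dots> \<le> q * marg ze / P"
      unfolding pmf_g using that P
      by (intro divide_right_mono mult_right_mono) (auto simp: A_def marg_def)
    finally show ?thesis
      by (simp add: m_def)
  qed

  have "measure_pmf.prob \<mu> (\<phi> \<inter> - A) \<le> \<epsilon> * \<kappa>"
  proof -
    let ?u = "\<lambda>(cs, zs, e). ennreal (PEF_product n F cs zs * g (cs, zs, e) powr \<beta>)"
    have "1 \<le> ennreal (\<epsilon> * \<kappa>) * ?u x" if "x \<in> \<phi> \<inter> - A" for x
    proof -
      obtain cs zs e where x: "x = (cs, zs, e)"
        by (cases x)
      have T: "1 / (p powr \<beta> * \<epsilon>) \<le> PEF_product n F cs zs"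
        using that by (simp add: \<phi> x)
      have "q < g x"
        using that by (simp add: A_def)
      then have "p powr \<beta> / \<kappa> \<le> g x powr \<beta>"
        using q \<beta> powr_mono2[of \<beta> q "g x"] by simp
      then have "1 / (p powr \<beta> * \<epsilon>) * (p powr \<beta> / \<kappa>) \<le> PEF_product n F cs zs * g x powr \<beta>"
        using T \<epsilon> \<kappa> p order_trans[OF _ T, of 0] by (intro mult_mono) auto
      then have "1 \<le> \<epsilon> * \<kappa> * (PEF_product n F cs zs * g x powr \<beta>)"
        using p \<epsilon> \<kappa> by (simp add: field_simps)
      then show ?thesis
        using \<epsilon> \<kappa> by (simp add: x ennreal_mult'[symmetric] del: ennreal_1 flip: ennreal_1)
    qed
    then have "emeasure (measure_pmf \<mu>) (\<phi> \<inter> - A) \<le> emeasure (measure_pmf \<mu>) {x \<in> UNIV. 1 \<le> ennreal (\<epsilon> * \<kappa>) * ?u x}"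
      by (intro emeasure_mono) auto
    also have "\<dots> \<le> ennreal (\<epsilon> * \<kappa>) * (\<integral>\<^sup>+x. ?u x * indicator UNIV x \<partial>measure_pmf \<mu>)"
      by (rule nn_integral_Markov_inequality) auto
    also have "\<dots> = ennreal (\<epsilon> * \<kappa>) * (\<integral>\<^sup>+x. ?u x \<partial>measure_pmf \<mu>)"
      by simp
    also have "\<dots> \<le> ennreal (\<epsilon> * \<kappa>) * 1"
      using joint_PEF_expectation[OF assms(8) \<open>set_pmf \<mu> \<subseteq> \<Omega>\<close>[unfolded \<Omega>] assms(10)]
      by (intro mult_left_mono) (simp_all add: g_def marg_def)
    finally show ?thesis
      using \<epsilon> \<kappa> by (simp add: measure_pmf.emeasure_eq_measure)
  qed
  also have "\<epsilon> * \<kappa> \<le> \<epsilon> * P"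
    using P \<epsilon> by simp
  finally have "measure_pmf.prob \<rho> (- A) \<le> \<epsilon>"
    using P(2) by (simp add: \<rho>_def measure_cond_pmf[OF ne] P_def pos_divide_le_eq)
  then have "1 - measure_pmf.prob \<rho> A \<le> \<epsilon>"
    using measure_pmf.prob_compl[of A \<rho>] by (simp add: Compl_eq_Diff_UNIV)

  moreover obtain K where K: "K \<subseteq> seq_space RC n" "finite K" "real (card K) * p \<ge> 1"
  proof (rule obtain_finite_subset_card_ge[OF _ p assms(17)])
    show "seq_space RC n \<noteq> {}"
      using \<open>set_pmf \<mu> \<subseteq> \<Omega>\<close> set_pmf_not_empty[of \<mu>] by (auto simp: \<Omega>)
  qed
  have K_room: "real (card K) * (q / P) \<ge> 1"
    using K(3) mult_left_mono[OF qP, of "real (card K)"] by simp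
  obtain \<nu> where \<nu>: "set_pmf \<nu> \<subseteq> set_pmf \<rho> \<union> K \<times> {ze. m ze \<noteq> 0}"
      "TV \<nu> \<rho> \<le> 1 - measure_pmf.prob \<rho> A" "\<And>c ze. pmf \<nu> (c, ze) \<le> m ze"
    using smoothing_below_envelope[where \<rho> = \<rho> and A = A, OF m_sum m0 _ K(2) K_room] \<rho>_le
    by blast
  \<comment> \<open>Smoothing stays in the value space: \<open>K\<close> consists of possible
    outputs, and \<open>m\<close> vanishes off the support of the marginal.\<close>
  have "set_pmf \<nu> \<subseteq> \<Omega>"
  proof -
    have "{ze. m ze \<noteq> 0} \<subseteq> snd ` set_pmf \<mu>"
      by (auto simp: m_def marg_def pmf_eq_0_set_pmf)
    then have "{ze. m ze \<noteq> 0} \<subseteq> seq_space RZ n \<times> RE"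
      using \<open>set_pmf \<mu> \<subseteq> \<Omega>\<close> by (force simp: \<Omega>)
    moreover have "set_pmf \<rho> \<subseteq> \<Omega>"
      using \<open>set_pmf \<mu> \<subseteq> \<Omega>\<close> by (auto simp: \<rho>_def set_cond_pmf[OF ne])
    ultimately show ?thesis
      using \<nu>(1) K(1) by (force simp: \<Omega>)
  qed
  ultimately have mem: "q / P \<in> {p. \<exists>\<nu>. set_pmf \<nu> \<subseteq> \<Omega> \<and> TV \<nu> \<rho> \<le> \<epsilon> \<and> guess_prob \<nu> \<le> p}"
    using \<nu>(2) guess_prob_le[OF m_sum \<nu>(3)] by (auto intro: order_trans)
  have nonneg: "0 \<le> r" if "r \<in> {p. \<exists>\<nu>. set_pmf \<nu> \<subseteq> \<Omega> \<and> TV \<nu> \<rho> \<le> \<epsilon> \<and> guess_prob \<nu> \<le> p}" for r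
    using that guess_prob_nonneg order_trans by blast
  have P_max_nonneg: "0 \<le> P_max \<Omega> \<epsilon> \<rho>"
    unfolding P_max_def using mem nonneg by (intro cInf_greatest) blast+
  have "P_max \<Omega> \<epsilon> \<rho> \<le> q / P"
    unfolding P_max_def using mem nonneg by (intro cInf_lower bdd_belowI) blast+
  also have "\<dots> \<le> q / \<kappa>"
    using P \<kappa> q by (intro divide_left_mono) auto
  \<comment> \<open>The exponent collects \<kappa>^(1/\<beta>) from q and one more \<kappa> from the
    bound 1/P \<le> 1/\<kappa>.\<close>
  also have "\<dots> = p / \<kappa> powr (1 + 1 / \<beta>)"
    using \<kappa> by (simp add: q_def powr_add)
  \<comment> \<open>If \<open>P_max\<close> is 0 the entropy is infinite and the bound trivial;
    otherwise the logarithm is monotone.\<close>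
  finally show ?thesis
    using P_max_nonneg by (auto simp: H_min_def \<rho>_def[symmetric] order_less_le intro!: log_mono)
qed

end
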